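(* Let $m\ge1$, let $0\le q\le m\le 2p$ be integers, and let $T=\{t_i\}_{i\in\mathbb{Z}}$ be a strictly increasing knot sequence of $\mathbb{R}$ with $|t_i|\to+\infty$ as $|i|\to+\infty$. For every $i\in\mathbb{Z}$, the minimization problem $$(M_i)\qquad \min\{\Vert a\Vert_1 \;:\; a\in\mathbb{R}^{2p+1},\ V_ia=b_i\}$$ has at least one solution (minimizer). In general the solution is not unique (that is, uniqueness fails for some instances of the data $m,p,q,T,i$).
   Context: For $i\in\mathbb{Z}$ and $0\le r\le m$, set $\theta_i^{(r)}=\sigma_r(T_i)/\binom{m}{r}$, where $\sigma_r(T_i)$ is the $r$-th elementary symmetric function of the $m$ knots $T_i=\{t_{i-m+1},\ldots,t_i\}$ (with $\sigma_0=1$), and $\theta_i=\theta_i^{(1)}=\frac1m\sum_{r=1}^m t_{i+1-r}$. Vectors $a\in\mathbb{R}^{2p+1}$ are indexed as $a=(a(s))_{-p\le s\le p}$, and $\Vert a\Vert_1=\sum_s|a(s)|$. The matrix $V_i\in\mathbb{R}^{(q+1)\times(2p+1)}$ has entries $V_i(r,s)=\theta_{i+s}^r$ ($0\le r\le q$, $-p\le s\le p$), and $b_i\in\mathbb{R}^{q+1}$ has components $b_i(r)=\theta_i^{(r)}$, $0\le r\le q$. (The constraint $V_ia_i=b_i$ for all $i$ expresses that the discrete quasi-interpolant $Qf=\sum_i\big(\sum_{s=-p}^p a_i(s)f(\theta_{i+s})\big)B_i$, with $B_i$ the degree $m$ B-splines, reproduces polynomials of degree at most $q$.) *)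

theory Defs
  imports Complex_Main "HOL-Library.FuncSet"
begin

text \<open>
  The limit is taken along \<open>filtercomap abs at_top\<close>, i.e. as the absolute value of the
  index tends to infinity, covering both ends of the integers.
\<close>
definition knot_sequence :: "(int \<Rightarrow> real) \<Rightarrow> bool" where
  "knot_sequence t \<longleftrightarrow>
     strict_mono t \<and>
     filterlim (\<lambda>i. \<bar>t i\<bar>) at_top (filtercomap (\<lambda>i::int. \<bar>i\<bar>) at_top)"

definition elem_sym :: "nat \<Rightarrow> int set \<Rightarrow> (int \<Rightarrow> real) \<Rightarrow> real" where
  "elem_sym r J t = (\<Sum>X | X \<subseteq> J \<and> card X = r. \<Prod>j\<in>X. t j)"

definition theta_sym :: "(int \<Rightarrow> real) \<Rightarrow> nat \<Rightarrow> nat \<Rightarrow> int \<Rightarrow> real" where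
  "theta_sym t m r i = elem_sym r {i - int m + 1..i} t / real (m choose r)"

definition theta :: "(int \<Rightarrow> real) \<Rightarrow> nat \<Rightarrow> int \<Rightarrow> real" where
  "theta t m i = theta_sym t m 1 i"

lemma theta_eq_average: "theta t m i = (\<Sum>r=1..m. t (i + 1 - int r)) / real m"
proof -
  have "{X. X \<subseteq> {i - int m + 1..i} \<and> card X = 1} = (\<lambda>j. {j}) ` {i - int m + 1..i}"
    by (auto simp: card_1_singleton_iff)
  then have "elem_sym 1 {i - int m + 1..i} t = (\<Sum>j\<in>{i - int m + 1..i}. t j)"
    by (simp add: elem_sym_def sum.reindex)
  also have "\<dots> = (\<Sum>r=1..m. t (i + 1 - int r))"
    by (rule sum.reindex_bij_witness[of _ "\<lambda>r. i + 1 - int r" "\<lambda>j. nat (i + 1 - j)"]) auto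
  finally show ?thesis
    by (simp add: theta_def theta_sym_def)
qed

text \<open>
  A vector in the space of dimension \<open>2p+1\<close>, indexed by \<open>-p, \<dots>, p\<close>, is an extensional
  function on that index set, so that equality of such functions is equality of vectors.
\<close>
definition vectors :: "nat \<Rightarrow> (int \<Rightarrow> real) set" where
  "vectors p = {- int p..int p} \<rightarrow>\<^sub>E UNIV"

definition norm1 :: "nat \<Rightarrow> (int \<Rightarrow> real) \<Rightarrow> real" where
  "norm1 p a = (\<Sum>s = - int p..int p. \<bar>a s\<bar>)"

definition V_mat :: "(int \<Rightarrow> real) \<Rightarrow> nat \<Rightarrow> int \<Rightarrow> nat \<Rightarrow> int \<Rightarrow> real" where
  "V_mat t m i r s = theta t m (i + s) ^ r"

definition b_vec :: "(int \<Rightarrow> real) \<Rightarrow> nat \<Rightarrow> int \<Rightarrow> nat \<Rightarrow> real" where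
  "b_vec t m i r = theta_sym t m r i"

definition feasible :: "nat \<Rightarrow> nat \<Rightarrow> nat \<Rightarrow> (int \<Rightarrow> real) \<Rightarrow> int \<Rightarrow> (int \<Rightarrow> real) \<Rightarrow> bool" where
  "feasible m p q t i a \<longleftrightarrow>
     a \<in> vectors p \<and> (\<forall>r\<le>q. (\<Sum>s = - int p..int p. V_mat t m i r s * a s) = b_vec t m i r)"

definition is_solution :: "nat \<Rightarrow> nat \<Rightarrow> nat \<Rightarrow> (int \<Rightarrow> real) \<Rightarrow> int \<Rightarrow> (int \<Rightarrow> real) \<Rightarrow> bool" where
  "is_solution m p q t i a \<longleftrightarrow> is_arg_min (norm1 p) (feasible m p q t i) a"

end

theory Submission
  imports Defs "HOL-Analysis.Function_Topology"
begin

text \<open>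
  Each problem \<open>(M\<^sub>i)\<close> has a feasible vector: the averages \<open>\<theta>\<^sub>j\<close> of a strictly increasing
  knot sequence are pairwise distinct, so \<open>V\<^sub>i\<close> is a Vandermonde matrix with
  \<open>2p + 1 \<ge> q + 1\<close> distinct nodes and every right-hand side is attained
  (lemma \<open>moment_problem_solvable\<close>). Once a feasible vector \<open>a\<close> is known, only the feasible
  vectors in the box of radius \<open>\<parallel>a\<parallel>\<^sub>1\<close> matter; they form a compact set on which the continuous
  function \<open>\<parallel>\<cdot>\<parallel>\<^sub>1\<close> attains its minimum (lemma \<open>norm1_min_exists\<close>).

  Uniqueness fails already for \<open>m = p = q = 1\<close> with the knots \<open>t\<^sub>j = j\<close>: then \<open>\<theta>\<^sub>j = j\<close>, and at
  \<open>i = 0\<close> the constraints read \<open>\<Sum>\<^sub>s a(s) = 1\<close> and \<open>\<Sum>\<^sub>s s a(s) = 0\<close>. The first one forces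
  \<open>\<parallel>a\<parallel>\<^sub>1 \<ge> 1\<close>, and both \<open>(0, 1, 0)\<close> and \<open>(1/2, 0, 1/2)\<close> attain this bound.
\<close>

lemma theta_strict_mono:
  assumes "1 \<le> m" "strict_mono t"
  shows "strict_mono (theta t m)"
proof (rule strict_monoI)
  fix i j :: int
  assume "i < j"
  have "(\<Sum>r=1..m. t (i + 1 - int r)) < (\<Sum>r=1..m. t (j + 1 - int r))"
    using assms \<open>i < j\<close> by (intro sum_strict_mono) (auto simp: strict_mono_less)
  then show "theta t m i < theta t m j"
    using assms by (simp add: theta_eq_average divide_strict_right_mono)
qed

lemma moment_problem_solvable_exact:
  fixes x :: "'a \<Rightarrow> 'b::field"
  assumes "finite S" "card S = Suc q" "inj_on x S"
  shows "\<exists>a. \<forall>r\<le>q. (\<Sum>s\<in>S. x s ^ r * a s) = b r"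
  using assms
proof (induction q arbitrary: S b)
  case 0
  then obtain z where "S = {z}"
    by (auto simp: card_1_singleton_iff)
  then show ?case
    by (intro exI[of _ "\<lambda>_. b 0"]) simp
next
  case (Suc q)
  then obtain z S' where S: "S = insert z S'" "z \<notin> S'" "card S' = Suc q" "finite S'"
    by (metis card_Suc_eq card.infinite nat.distinct(1))
  \<comment> \<open>Subtracting \<open>x z\<close> times one equation from the next one eliminates the unknown at \<open>z\<close>.\<close>
  obtain c where c: "\<And>r. r \<le> q \<Longrightarrow> (\<Sum>s\<in>S'. x s ^ r * c s) = b (Suc r) - x z * b r"
    using Suc.IH[of S' "\<lambda>r. b (Suc r) - x z * b r"] S Suc.prems by (auto simp: inj_on_insert)
  define d where "d s = c s / (x s - x z)" for s
  define a where "a = d(z := b 0 - sum d S')"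
  have ne: "x s - x z \<noteq> 0" if "s \<in> S'" for s
    using that Suc.prems S by (auto simp: inj_on_def)
  have split: "(\<Sum>s\<in>S. x s ^ r * a s) = x z ^ r * (b 0 - sum d S') + (\<Sum>s\<in>S'. x s ^ r * d s)" for r
  proof -
    have "(\<Sum>s\<in>S'. x s ^ r * a s) = (\<Sum>s\<in>S'. x s ^ r * d s)"
      using S by (intro sum.cong) (auto simp: a_def)
    then show ?thesis
      using S by (simp add: a_def)
  qed
  have "(\<Sum>s\<in>S. x s ^ r * a s) = b r" if "r \<le> Suc q" for r
    using that
  proof (induction r)
    case 0
    then show ?case by (simp only: split) simp
  next
    case (Suc r)
    have "(\<Sum>s\<in>S'. x s ^ Suc r * d s) - x z * (\<Sum>s\<in>S'. x s ^ r * d s)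
        = (\<Sum>s\<in>S'. x s ^ r * ((x s - x z) * d s))"
      by (simp add: sum_distrib_left sum_subtractf [symmetric] algebra_simps)
    also have "\<dots> = (\<Sum>s\<in>S'. x s ^ r * c s)"
      using ne by (intro sum.cong) (auto simp: d_def)
    also have "\<dots> = b (Suc r) - x z * b r"
      using Suc.prems by (intro c) simp
    finally have "(\<Sum>s\<in>S'. x s ^ Suc r * d s) =
        x z * (\<Sum>s\<in>S'. x s ^ r * d s) + b (Suc r) - x z * b r"
      by (simp add: algebra_simps)
    moreover have "x z ^ r * (b 0 - sum d S') = b r - (\<Sum>s\<in>S'. x s ^ r * d s)"
      using Suc split[of r] by (simp add: eq_diff_eq)
    then have "x z ^ Suc r * (b 0 - sum d S') = x z * (b r - (\<Sum>s\<in>S'. x s ^ r * d s))"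
      by (simp only: power_Suc mult.assoc)
    ultimately show ?case
      by (simp only: split) (simp add: right_diff_distrib)
  qed
  then show ?case by blast
qed

lemma moment_problem_solvable:
  fixes x :: "'a \<Rightarrow> 'b::field"
  assumes "finite S" "q < card S" "inj_on x S"
  shows "\<exists>a. \<forall>r\<le>q. (\<Sum>s\<in>S. x s ^ r * a s) = b r"
proof -
  obtain S' where S': "S' \<subseteq> S" "card S' = Suc q"
    using assms by (metis Suc_leI obtain_subset_with_card_n)
  moreover have "finite S'" "inj_on x S'"
    using S' assms by (auto intro: finite_subset inj_on_subset)
  ultimately obtain a where a: "\<And>r. r \<le> q \<Longrightarrow> (\<Sum>s\<in>S'. x s ^ r * a s) = b r"
    using moment_problem_solvable_exact[of S' q x b] by blast
  have "(\<Sum>s\<in>S. x s ^ r * (if s \<in> S' then a s else 0)) = (\<Sum>s\<in>S'. x s ^ r * a s)" for r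
    using S' assms by (intro sum.mono_neutral_cong_right) auto
  then show ?thesis
    using a by (intro exI[of _ "\<lambda>s. if s \<in> S' then a s else 0"]) simp
qed

lemma feasible_exists:
  assumes "1 \<le> m" "q \<le> 2 * p" "strict_mono t"
  shows "\<exists>a. feasible m p q t i a"
proof -
  let ?S = "{- int p..int p}"
  have "inj_on (\<lambda>s. theta t m (i + s)) ?S"
    using strict_mono_eq[OF theta_strict_mono[OF assms(1,3)]] by (auto simp: inj_on_def)
  moreover have "q < card ?S"
    using assms by simp
  ultimately obtain a where
    "\<forall>r\<le>q. (\<Sum>s\<in>?S. theta t m (i + s) ^ r * a s) = b_vec t m i r"
    using moment_problem_solvable[of ?S q _ "b_vec t m i"] by blast
  then have "feasible m p q t i (restrict a ?S)"
    by (simp add: feasible_def vectors_def V_mat_def)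
  then show ?thesis by blast
qed

lemma abs_le_norm1:
  assumes "s \<in> {- int p..int p}"
  shows "\<bar>a s\<bar> \<le> norm1 p a"
  unfolding norm1_def by (rule member_le_sum[OF assms]) auto

lemma norm1_min_exists:
  assumes "feasible m p q t i a0"
  shows "\<exists>a. is_solution m p q t i a"
proof -
  let ?S = "{- int p..int p}"
  let ?M = "norm1 p a0"
  \<comment> \<open>Extensional functions are constantly \<open>undefined\<close> off the index set; the box is therefore
    taken over all integers, with a single point as the factor at the indices off that set.\<close>
  define K :: "(int \<Rightarrow> real) set" where
    "K = PiE UNIV (\<lambda>s. if s \<in> ?S then {-?M..?M} else {undefined})"
  define C where "C = (\<Inter>r\<in>{..q}. {a. (\<Sum>s\<in>?S. V_mat t m i r s * a s) = b_vec t m i r})"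
  have "compactin (product_topology (\<lambda>_. euclidean) UNIV) K"
    unfolding K_def compactin_PiE by auto
  then have "compact K"
    by (simp add: euclidean_product_topology)
  moreover have "closed C"
    unfolding C_def
    by (intro closed_INT ballI closed_Collect_eq continuous_intros
        continuous_on_product_coordinates)
  ultimately have "compact (K \<inter> C)"
    by (rule compact_Int_closed)
  have box: "a \<in> K \<inter> C" if "feasible m p q t i a" "norm1 p a \<le> ?M" for a
  proof -
    have "\<bar>a s\<bar> \<le> ?M" if "s \<in> ?S" for s
      using abs_le_norm1[OF that, of a] \<open>norm1 p a \<le> ?M\<close> by linarith
    then show ?thesis
      using that by (fastforce simp: K_def C_def feasible_def vectors_def PiE_iff abs_le_iff
          extensional_def)
  qed
  have feas: "feasible m p q t i a" if "a \<in> K \<inter> C" for a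
    using that by (auto simp: K_def C_def feasible_def vectors_def PiE_iff extensional_def
        split: if_splits)
  have "K \<inter> C \<noteq> {}"
    using box[OF assms] by blast
  moreover have "continuous_on (K \<inter> C) (norm1 p)"
    unfolding norm1_def
    by (intro continuous_intros continuous_on_subset[OF continuous_on_product_coordinates]) auto
  ultimately obtain a where a: "a \<in> K \<inter> C" "\<And>c. c \<in> K \<inter> C \<Longrightarrow> norm1 p a \<le> norm1 p c"
    using continuous_attains_inf[OF \<open>compact (K \<inter> C)\<close>] by blast
  have "norm1 p a \<le> norm1 p c" if "feasible m p q t i c" for c
  proof (cases "norm1 p c \<le> ?M")
    case True
    then show ?thesis using a(2) box that by blast
  next
    case False
    then show ?thesis using a(2)[OF box[OF assms]] by simp
  qed
  then have "is_solution m p q t i a"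
    using feas[OF a(1)] by (simp add: is_solution_def is_arg_min_linorder)
  then show ?thesis by blast
qed

lemma theta_sym_0: "theta_sym t m 0 i = 1"
proof -
  have "{X. X \<subseteq> {i - int m + 1..i} \<and> card X = 0} = {{}}"
    by (auto dest: finite_subset)
  then show ?thesis
    by (simp add: theta_sym_def elem_sym_def)
qed

text \<open>The equation for \<open>r = 0\<close> says that the coefficients sum to 1.\<close>
lemma norm1_ge_1_if_feasible:
  assumes "feasible m p q t i a"
  shows "1 \<le> norm1 p a"
proof -
  have "(\<Sum>s = - int p..int p. a s) = 1"
    using assms by (auto simp: feasible_def V_mat_def b_vec_def theta_sym_0 dest: spec[of _ 0])
  moreover have "\<bar>\<Sum>s = - int p..int p. a s\<bar> \<le> norm1 p a"
    unfolding norm1_def by (rule sum_abs)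
  ultimately show ?thesis by simp
qed

lemma is_solution_if_norm1_eq_1:
  assumes "feasible m p q t i a" "norm1 p a = 1"
  shows "is_solution m p q t i a"
  using assms norm1_ge_1_if_feasible by (simp add: is_solution_def is_arg_min_linorder)

lemma knot_sequence_of_int: "knot_sequence real_of_int"
proof -
  have "filterlim (\<lambda>i::int. real_of_int \<bar>i\<bar>) at_top (filtercomap (\<lambda>i. \<bar>i\<bar>) at_top)"
    by (rule filterlim_compose[OF filterlim_real_of_int_at_top filterlim_filtercomap])
  then show ?thesis
    by (simp add: knot_sequence_def strict_mono_def)
qed

lemma uniform_linear_not_unique:
  fixes a a' :: "int \<Rightarrow> real"
  defines "a \<equiv> restrict (\<lambda>s. if s = 0 then 1 else 0) {-1..1}"
    and "a' \<equiv> restrict (\<lambda>s. if s = 0 then 0 else 1 / 2) {-1..1}"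
  shows "is_solution 1 1 1 real_of_int 0 a" "is_solution 1 1 1 real_of_int 0 a'" "a \<noteq> a'"
proof -
  have theta: "theta real_of_int 1 j = real_of_int j" for j
    by (simp add: theta_eq_average)
  have S: "{-1..1::int} = {-1, 0, 1}"
    by auto
  have b: "b_vec real_of_int 1 0 0 = 1" "b_vec real_of_int 1 0 1 = 0"
    using theta[of 0] by (simp_all add: b_vec_def theta_sym_0 theta_def)
  have feasI: "feasible 1 1 1 real_of_int 0 c"
    if "c \<in> extensional {-1..1}" "c (-1) + c 0 + c 1 = 1" "c 1 = c (-1)" for c
    using that b theta unfolding feasible_def vectors_def V_mat_def
    by (auto simp: le_Suc_eq S PiE_def)
  have "norm1 1 a = 1" "norm1 1 a' = 1"
    by (simp_all add: norm1_def a_def a'_def S)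
  moreover have "feasible 1 1 1 real_of_int 0 a" "feasible 1 1 1 real_of_int 0 a'"
    by (rule feasI; simp add: a_def a'_def)+
  ultimately show "is_solution 1 1 1 real_of_int 0 a" "is_solution 1 1 1 real_of_int 0 a'"
    by (simp_all only: is_solution_if_norm1_eq_1)
  have "a 0 \<noteq> a' 0"
    by (simp add: a_def a'_def)
  then show "a \<noteq> a'"
    by metis
qed

theorem theorem2:
  "(\<forall>(m::nat) (p::nat) (q::nat) (t :: int \<Rightarrow> real).
      1 \<le> m \<and> q \<le> m \<and> m \<le> 2 * p \<and> knot_sequence t \<longrightarrow>
      (\<forall>i::int. \<exists>a. is_solution m p q t i a))
   \<and>
   (\<exists>(m::nat) (p::nat) (q::nat) (t :: int \<Rightarrow> real) (i::int).
      1 \<le> m \<and> q \<le> m \<and> m \<le> 2 * p \<and> knot_sequence t \<and>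
      (\<exists>a a'. is_solution m p q t i a \<and> is_solution m p q t i a' \<and> a \<noteq> a'))"
proof (intro conjI allI impI)
  fix m p q :: nat and t :: "int \<Rightarrow> real" and i :: int
  assume "1 \<le> m \<and> q \<le> m \<and> m \<le> 2 * p \<and> knot_sequence t"
  then have "\<exists>a. feasible m p q t i a"
    by (intro feasible_exists) (auto simp: knot_sequence_def)
  then show "\<exists>a. is_solution m p q t i a"
    using norm1_min_exists by blast
next
  have "(1::nat) \<le> 1 \<and> (1::nat) \<le> 1 \<and> (1::nat) \<le> 2 * 1"
    by simp
  then show "\<exists>(m::nat) (p::nat) (q::nat) (t :: int \<Rightarrow> real) (i::int).
      1 \<le> m \<and> q \<le> m \<and> m \<le> 2 * p \<and> knot_sequence t \<and>
      (\<exists>a a'. is_solution m p q t i a \<and> is_solution m p q t i a' \<and> a \<noteq> a')"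
    using knot_sequence_of_int uniform_linear_not_unique by blast
qed

end
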